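(* Let $f:\mathbb{C}^2\to\mathbb{C}$ be the mixed polynomial $$f(z_1,z_2)=z_2^2\bar z_2-6z_1^2z_2\bar z_2+11z_1^2\bar z_1^2z_2-6z_1^4\bar z_1^2 .$$ Then the following hold. (1) $f$ has no mixed critical points on $(\mathbb{C}^* )^2$. (2) The restriction $f:(\mathbb{C}^* )^2\to\mathbb{C}$ is surjective. (3) The $0$-dimensional face functions $f_S=z_2^2\bar z_2$ and $f_T=-6z_1^4\bar z_1^2$ of the germ $(f,\mathbf{0})$, where $S={}^t(1,1)$ and $T={}^t(1,3)$, also have no mixed critical points on $(\mathbb{C}^* )^2$. Thus, the germ $(f,\mathbf{0})$ is strongly Newton non-degenerate.
   Context: $\mathbb{C}^*=\mathbb{C}\setminus\{0\}$ and $\bar z$ denotes complex conjugation. A mixed polynomial is a finite sum $f(\mathbf z,\bar{\mathbf z})=\sum_{\nu,\mu}c_{\nu,\mu}\mathbf z^\nu\bar{\mathbf z}^\mu$ with $c_{\nu,\mu}\in\mathbb{C}$ and multi-indices $\nu,\mu$ of non-negative integers, $\mathbf z=(z_1,\dots,z_n)$, regarded as a (real analytic) function $\mathbb{C}^n\to\mathbb{C}$. Mixed critical point: a point $\mathbf a$ is a mixed critical point of $f$ if the real differential $(df)_{\mathbf a}:T_{\mathbf a}\mathbb{C}^n\to T_{f(\mathbf a)}\mathbb{C}\cong\mathbb{R}^2$ has (real) rank less than $2$. Radial Newton polyhedron and face functions: for a mixed polynomial $f$ with $f(\mathbf 0)=0$, $\Gamma_+(f)$ is the convex hull of $\bigcup_{c_{\nu,\mu}\neq0}\big((\nu+\mu)+\mathbb{R}_{\ge0}^n\big)$.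 For a non-zero weight vector $P={}^t(p_1,\dots,p_n)$ with non-negative integer entries, let $P(\xi)=\sum_jp_j\xi_j$, let $d(P)$ be the minimum of $P$ on $\Gamma_+(f)$, and let $\Delta(P)=\{\xi\in\Gamma_+(f): P(\xi)=d(P)\}$; such sets are the faces of $\Gamma_+(f)$. A face is compact if and only if it equals $\Delta(P)$ for some $P$ with all $p_i>0$. For a compact face $\Delta=\Delta(P)$, the face function is $f_\Delta=f_P=\sum_{\nu+\mu\in\Delta}c_{\nu,\mu}\mathbf z^\nu\bar{\mathbf z}^\mu$. Strong Newton non-degeneracy: for a compact face $\Delta$ with $\dim\Delta\ge1$, the germ $(f,\mathbf 0)$ is strongly Newton non-degenerate over $\Delta$ if $f_\Delta:(\mathbb{C}^* )^n\to\mathbb{C}$ has no mixed critical points and is surjective onto $\mathbb{C}$; for a compact face $\Delta$ with $\dim\Delta=0$ (a vertex), it is strongly Newton non-degenerate over $\Delta$ if $f_\Delta:(\mathbb{C}^* )^n\to\mathbb{C}$ has no mixed critical points. The germ $(f,\mathbf 0)$ is strongly Newton non-degenerate if it is so over every compact face. For the polynomial $f$ of the claim ($n=2$), the compact faces of $\Gamma_+(f)$ are $\Delta(P)$, $\Delta(S)$, $\Delta(T)$ with $P={}^t(1,2)$, $S={}^t(1,1)$, $T={}^t(1,3)$; the face $\Delta(P)$ is $1$-dimensional with $f_P=f$, and $\Delta(S),\Delta(T)$ are vertices. *)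

theory Defs
  imports "HOL-Analysis.Analysis" "HOL-Library.Poly_Mapping"
begin

text \<open>
  The key \<open>(\<nu>, \<mu>)\<close> stands for the monomial \<open>z\<^sup>\<nu> \<cdot> cnj z\<^sup>\<mu>\<close>. Keys form a commutative monoid, so mixed
  polynomials inherit the (convolution) ring structure of \<open>\<Rightarrow>\<^sub>0\<close>.
\<close>

type_synonym 'n mixed_poly = "((nat ^ 'n) \<times> (nat ^ 'n)) \<Rightarrow>\<^sub>0 complex"

definition Z :: "'n::finite \<Rightarrow> 'n mixed_poly" where
  "Z j = Poly_Mapping.single (axis j 1, 0) 1"

definition Zbar :: "'n::finite \<Rightarrow> 'n mixed_poly" where
  "Zbar j = Poly_Mapping.single (0, axis j 1) 1"

definition mixed_monom :: "(nat ^ 'n) \<times> (nat ^ 'n) \<Rightarrow> complex ^ 'n::finite \<Rightarrow> complex" where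
  "mixed_monom k z = (\<Prod>j\<in>UNIV. (z $ j) ^ (fst k $ j)) * (\<Prod>j\<in>UNIV. (cnj (z $ j)) ^ (snd k $ j))"

definition mixed_eval :: "'n::finite mixed_poly \<Rightarrow> complex ^ 'n \<Rightarrow> complex" where
  "mixed_eval f z = (\<Sum>k\<in>Poly_Mapping.keys f. Poly_Mapping.lookup f k * mixed_monom k z)"

definition complex_torus :: "(complex ^ 'n::finite) set" where
  "complex_torus = {z. \<forall>j. z $ j \<noteq> 0}"

text \<open>
  \<^const>\<open>frechet_derivative\<close> is the real differential, and \<open>dim\<close> is the dimension over the reals.
  Mixed polynomial functions are differentiable everywhere (\<open>mixed_eval_differentiable\<close> below).
\<close>

definition mixed_critical_point :: "'n::finite mixed_poly \<Rightarrow> complex ^ 'n \<Rightarrow> bool" where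
  "mixed_critical_point f a \<longleftrightarrow> dim (range (frechet_derivative (mixed_eval f) (at a))) < 2"

definition radial_exponent :: "(nat ^ 'n) \<times> (nat ^ 'n) \<Rightarrow> real ^ 'n::finite" where
  "radial_exponent k = (\<chi> j. real (fst k $ j + snd k $ j))"

definition newton_polyhedron :: "'n::finite mixed_poly \<Rightarrow> (real ^ 'n) set" where
  "newton_polyhedron f =
     convex hull (\<Union>k\<in>Poly_Mapping.keys f. {radial_exponent k + \<eta> | \<eta>. \<forall>j. 0 \<le> \<eta> $ j})"

definition weight_form :: "nat ^ 'n \<Rightarrow> real ^ 'n::finite \<Rightarrow> real" where
  "weight_form P \<xi> = (\<Sum>j\<in>UNIV. real (P $ j) * \<xi> $ j)"

text \<open>
  For \<open>f \<noteq> 0\<close> the infimum is attained, because \<open>P\<close> has non-negative entries.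
\<close>

definition weight_min :: "'n::finite mixed_poly \<Rightarrow> nat ^ 'n \<Rightarrow> real" where
  "weight_min f P = (INF \<xi>\<in>newton_polyhedron f. weight_form P \<xi>)"

definition newton_face :: "'n::finite mixed_poly \<Rightarrow> nat ^ 'n \<Rightarrow> (real ^ 'n) set" where
  "newton_face f P = {\<xi> \<in> newton_polyhedron f. weight_form P \<xi> = weight_min f P}"

definition compact_face :: "'n::finite mixed_poly \<Rightarrow> (real ^ 'n) set \<Rightarrow> bool" where
  "compact_face f \<Delta> \<longleftrightarrow> (\<exists>P. P \<noteq> 0 \<and> \<Delta> = newton_face f P) \<and> compact \<Delta>"

definition face_function :: "'n::finite mixed_poly \<Rightarrow> (real ^ 'n) set \<Rightarrow> 'n mixed_poly" where
  "face_function f \<Delta> =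
     (\<Sum>k\<in>{k \<in> Poly_Mapping.keys f. radial_exponent k \<in> \<Delta>}.
        Poly_Mapping.single k (Poly_Mapping.lookup f k))"

definition strongly_nondegenerate_over ::
    "'n::finite mixed_poly \<Rightarrow> (real ^ 'n) set \<Rightarrow> bool" where
  "strongly_nondegenerate_over f \<Delta> \<longleftrightarrow>
     (aff_dim \<Delta> \<ge> 1 \<longrightarrow>
        (\<forall>a\<in>complex_torus. \<not> mixed_critical_point (face_function f \<Delta>) a) \<and>
        mixed_eval (face_function f \<Delta>) ` complex_torus = UNIV) \<and>
     (aff_dim \<Delta> = 0 \<longrightarrow>
        (\<forall>a\<in>complex_torus. \<not> mixed_critical_point (face_function f \<Delta>) a))"

text \<open>
  The first conjunct is the standing assumption under which the Newton polyhedron of the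
  germ at the origin is considered.
\<close>

definition strongly_newton_nondegenerate :: "'n::finite mixed_poly \<Rightarrow> bool" where
  "strongly_newton_nondegenerate f \<longleftrightarrow>
     mixed_eval f 0 = 0 \<and> (\<forall>\<Delta>. compact_face f \<Delta> \<longrightarrow> strongly_nondegenerate_over f \<Delta>)"

lemma mixed_eval_differentiable: "mixed_eval f differentiable (at a)"
proof -
  have cmp: "(\<lambda>z::complex^'a. z $ j) differentiable (at a)" for j
    by (intro bounded_linear_imp_differentiable bounded_linear_vec_nth)
  have cnjd: "(\<lambda>z::complex^'a. cnj (z $ j)) differentiable (at a)" for j
    by (intro bounded_linear_imp_differentiable bounded_linear_compose[OF bounded_linear_cnj] bounded_linear_vec_nth)
  have pr: "(\<lambda>z. \<Prod>j\<in>A. h j z) differentiable (at a)"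
    if "finite A" "\<And>j. h j differentiable (at a)" for A and h :: "'a \<Rightarrow> complex^'a \<Rightarrow> complex"
    using that by (induction A rule: finite_induct) (auto intro!: differentiable_mult)
  have "(\<lambda>z. mixed_monom k z) differentiable (at a)" for k :: "(nat^'a) \<times> (nat^'a)"
    unfolding mixed_monom_def
    by (intro differentiable_mult pr differentiable_power cmp cnjd) auto
  then show ?thesis
    unfolding mixed_eval_def[abs_def]
    by (intro differentiable_sum differentiable_mult differentiable_const) auto
qed

lemma mixed_eval_superset:
  assumes "finite A" "Poly_Mapping.keys f \<subseteq> A"
  shows "mixed_eval f z = (\<Sum>k\<in>A. Poly_Mapping.lookup f k * mixed_monom k z)"
  unfolding mixed_eval_def
  by (rule sum.mono_neutral_left[OF assms]) (auto simp: in_keys_iff)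

lemma mixed_eval_single [simp]: "mixed_eval (Poly_Mapping.single k c) z = c * mixed_monom k z"
  by (subst mixed_eval_superset[of "{k}"]) (auto simp: lookup_single)

lemma mixed_eval_zero [simp]: "mixed_eval 0 z = 0"
  by (simp add: mixed_eval_def)

lemma mixed_eval_add [simp]: "mixed_eval (f + g) z = mixed_eval f z + mixed_eval g z"
  using Poly_Mapping.keys_add[of f g]
  by (simp add: mixed_eval_superset[of "Poly_Mapping.keys f \<union> Poly_Mapping.keys g"]
      lookup_add algebra_simps sum.distrib)

lemma mixed_eval_diff [simp]: "mixed_eval (f - g) z = mixed_eval f z - mixed_eval g z"
  using mixed_eval_add[of "f - g" g z] by simp

lemma mixed_monom_add: "mixed_monom (k + l) z = mixed_monom k z * mixed_monom l z"
  by (simp add: mixed_monom_def power_add prod.distrib)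

lemma mixed_poly_induct [case_names zero single_add]:
  assumes "P 0" and step: "\<And>f k c. P f \<Longrightarrow> P (Poly_Mapping.single k c + f)"
  shows "P (f :: 'n::finite mixed_poly)"
proof (induction f rule: update_induct)
  case (update f k c)
  have "Poly_Mapping.update k c f = Poly_Mapping.single k c + f"
    using update(1)
    by (intro poly_mapping_eqI) (auto simp: lookup_update lookup_add lookup_single in_keys_iff when_def)
  then show ?case
    using step[OF update(3)] by simp
qed (fact assms(1))

lemma mixed_eval_single_mult:
  "mixed_eval (Poly_Mapping.single k c * g) z = c * mixed_monom k z * mixed_eval g z"
  by (induction g rule: mixed_poly_induct)
     (simp_all add: mult_single mixed_monom_add distrib_left)

lemma mixed_eval_mult [simp]: "mixed_eval (f * g) z = mixed_eval f z * mixed_eval g z"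
  by (induction f rule: mixed_poly_induct)
     (simp_all add: mixed_eval_single_mult distrib_right)

lemma mixed_eval_one [simp]: "mixed_eval 1 z = 1"
  by (simp flip: single_one add: mixed_monom_def)

lemma mixed_eval_power [simp]: "mixed_eval (f ^ m) z = mixed_eval f z ^ m"
  by (induction m) simp_all

lemma mixed_eval_numeral [simp]: "mixed_eval (numeral m) z = numeral m"
  by (simp flip: single_numeral add: mixed_monom_def)

lemma mixed_eval_Z [simp]: "mixed_eval (Z j) z = z $ j"
proof -
  have "(z $ i) ^ (axis j 1 $ i) = (if i = j then z $ i else 1)" for i
    by (simp add: axis_def)
  then show ?thesis
    by (simp add: Z_def mixed_monom_def)
qed

lemma mixed_eval_Zbar [simp]: "mixed_eval (Zbar j) z = cnj (z $ j)"
proof -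
  have "(cnj (z $ i)) ^ (axis j 1 $ i) = (if i = j then cnj (z $ i) else 1)" for i
    by (simp add: axis_def)
  then show ?thesis
    by (simp add: Zbar_def mixed_monom_def)
qed

end

theory Submission imports Defs begin

text \<open>
  Write \<open>u = z\<^sub>1\<^sup>2\<close>. Every monomial of the polynomial has degree \<open>3\<close> in \<open>(u, cnj u, z\<^sub>2, cnj z\<^sub>2)\<close>,
  two of these factors being holomorphic and one antiholomorphic, so with \<open>z\<^sub>2 = \<zeta> u\<close> it factors as
  \<open>u |u|\<^sup>2 g(\<zeta>)\<close>, where \<open>g(\<zeta>) = \<zeta>\<^sup>2 cnj \<zeta> - 6 \<zeta> cnj \<zeta> + 11 \<zeta> - 6\<close>. For real \<open>t\<close> this is
  \<open>g(t) = (t - 1) (t - 2) (t - 3)\<close>, and \<open>g\<close> has no other zeros: \<open>g(\<zeta>) = 0\<close> says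
  \<open>\<zeta> (|\<zeta>|\<^sup>2 + 11) = 6 |\<zeta>|\<^sup>2 + 6\<close>, which forces \<open>\<zeta>\<close> to be real (\<open>mixed_cubic_zero_cases\<close>).

  Where the value \<open>c\<close> is not zero, there are no critical points, since the function is homogeneous
  for the weights \<open>(1, 2)\<close> both under positive real scaling, of degree \<open>6\<close>, and under rotation, of
  degree \<open>2\<close>. The derivatives along the two orbits are \<open>6 c\<close> and \<open>2 \<i> c\<close>, and they span the plane.
  On the zero set, that is on \<open>z\<^sub>2 = t u\<close> with \<open>t \<in> {1, 2, 3}\<close>, the differential is already onto in
  the direction of \<open>z\<^sub>2\<close> alone: \<open>h \<mapsto> \<alpha> h + \<beta> cnj h\<close> is onto unless \<open>|\<alpha>| = |\<beta>|\<close>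
  (\<open>surj_wirtinger\<close>), and here \<open>|\<alpha>| : |\<beta>|\<close> is \<open>7 : 5\<close>, \<open>7 : 8\<close> and \<open>11 : 9\<close>.
  The same criterion handles the vertices, whose face functions \<open>c z\<^sup>p cnj z\<^sup>q\<close> have
  \<open>|\<alpha>| : |\<beta>| = p : q\<close> (\<open>pure_monomial_not_critical\<close>).

  Surjectivity on the torus follows by restricting to \<open>\<zeta> = 4\<close>, where the function is \<open>6 u |u|\<^sup>2\<close> and
  takes every nonzero value; the value \<open>0\<close> is attained at \<open>(1, 1)\<close>.

  The Newton polyhedron is the part of the quadrant with \<open>\<xi>\<^sub>1 + 2 \<xi>\<^sub>2 \<ge> 6\<close>. A weight with a zero
  entry cuts out an unbounded face; the compact faces are the vertices \<open>(0, 3)\<close> and \<open>(6, 0)\<close> and the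
  edge joining them, which contains all exponents, so that its face function is the whole
  polynomial.
\<close>

section \<open>Wirtinger derivatives and critical points\<close>

lemma not_mixed_critical_pointI:
  assumes D: "(mixed_eval f has_derivative D) (at a)" and surj: "\<And>w. \<exists>v. D v = w"
  shows "\<not> mixed_critical_point f a"
proof -
  have "frechet_derivative (mixed_eval f) (at a) = D"
    using frechet_derivative_at[OF D] by simp
  moreover have "range D = UNIV"
    using surj by (metis surjI)
  ultimately show ?thesis
    by (simp add: mixed_critical_point_def)
qed

text \<open>
  The equation and its conjugate form a linear system in \<open>h\<close> and \<open>cnj h\<close> with determinant
  \<open>|\<alpha>|\<^sup>2 - |\<beta>|\<^sup>2\<close>; Cramer's rule gives the solution.
\<close>

lemma surj_wirtinger:
  fixes \<alpha> \<beta> w :: complex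
  assumes "cmod \<alpha> \<noteq> cmod \<beta>"
  shows "\<exists>h. \<alpha> * h + \<beta> * cnj h = w"
proof -
  define d where "d = \<alpha> * cnj \<alpha> - \<beta> * cnj \<beta>"
  have "(cmod \<alpha>)\<^sup>2 \<noteq> (cmod \<beta>)\<^sup>2"
    using assms by simp
  moreover have d_norms: "d = of_real ((cmod \<alpha>)\<^sup>2 - (cmod \<beta>)\<^sup>2)"
    by (simp add: d_def complex_norm_square flip: of_real_power)
  ultimately have "d \<noteq> 0"
    by (metis of_real_eq_0_iff right_minus_eq)
  moreover have "cnj d = d"
    by (simp add: d_norms)
  ultimately have "\<alpha> * ((cnj \<alpha> * w - \<beta> * cnj w) / d) + \<beta> * cnj ((cnj \<alpha> * w - \<beta> * cnj w) / d) = w"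
    by (simp add: divide_simps) (simp add: d_def algebra_simps)
  then show ?thesis ..
qed

text \<open>
  The form in which the radial and the rotational Euler identities are used: a radial derivative
  \<open>p c\<close> and a rotational derivative \<open>\<i> q c\<close> are nonzero and orthogonal, hence span \<open>\<complex>\<close> over \<open>\<real>\<close>.
\<close>

lemma surj_rotated_pair:
  fixes c w :: complex and p q :: real
  assumes "c \<noteq> 0" "p \<noteq> 0" "q \<noteq> 0"
  shows "\<exists>x y :: real. x *\<^sub>R (of_real p * c) + y *\<^sub>R (\<i> * of_real q * c) = w"
proof (intro exI)
  have "w / c = of_real (Re (w / c)) + \<i> * of_real (Im (w / c))"
    by (rule complex_eq)
  then have "w = (of_real (Re (w / c)) + \<i> * of_real (Im (w / c))) * c"
    using \<open>c \<noteq> 0\<close> by (metis nonzero_divide_eq_eq)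
  then show "(Re (w / c) / p) *\<^sub>R (of_real p * c) + (Im (w / c) / q) *\<^sub>R (\<i> * of_real q * c) = w"
    using assms by (simp add: scaleR_conv_of_real algebra_simps)
qed

section \<open>The mixed polynomial\<close>

definition mixed_cubic :: "2 mixed_poly" where
  "mixed_cubic = Z 2 ^ 2 * Zbar 2 - 6 * Z 1 ^ 2 * Z 2 * Zbar 2
                + 11 * Z 1 ^ 2 * Zbar 1 ^ 2 * Z 2 - 6 * Z 1 ^ 4 * Zbar 1 ^ 2"

lemma mixed_eval_uminus: "mixed_eval (- f) z = - mixed_eval f z"
  using mixed_eval_diff[of 0 f z] by simp

lemma has_derivative_cnj_nth [derivative_intros]:
  "((\<lambda>z. cnj (z $ j)) has_derivative (\<lambda>v. cnj (v $ j))) F"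
  by (intro bounded_linear_imp_has_derivative bounded_linear_compose[OF bounded_linear_cnj]
      bounded_linear_vec_nth)

lemma has_derivative_nth:
  "((\<lambda>z. z $ j) has_derivative (\<lambda>v. v $ j)) F"
  by (intro bounded_linear_imp_has_derivative bounded_linear_vec_nth)

lemma mixed_eval_mixed_cubic:
  "mixed_eval mixed_cubic = (\<lambda>z. (z $ 2) ^ 2 * cnj (z $ 2) - 6 * (z $ 1) ^ 2 * z $ 2 * cnj (z $ 2)
     + 11 * (z $ 1) ^ 2 * cnj (z $ 1) ^ 2 * z $ 2 - 6 * (z $ 1) ^ 4 * cnj (z $ 1) ^ 2)"
  by (auto simp: mixed_cubic_def)

lemma has_derivative_mixed_cubic:
  fixes a :: "complex ^ 2"
  defines "z1 \<equiv> a $ 1" and "z2 \<equiv> a $ 2"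
  shows "(mixed_eval mixed_cubic has_derivative (\<lambda>v.
       (2 * z2 * cnj z2 - 6 * z1 ^ 2 * cnj z2 + 11 * z1 ^ 2 * cnj z1 ^ 2) * v $ 2
     + (z2 ^ 2 - 6 * z1 ^ 2 * z2) * cnj (v $ 2)
     + (- 12 * z1 * z2 * cnj z2 + 22 * z1 * cnj z1 ^ 2 * z2 - 24 * z1 ^ 3 * cnj z1 ^ 2) * v $ 1
     + (22 * z1 ^ 2 * cnj z1 * z2 - 12 * z1 ^ 4 * cnj z1) * cnj (v $ 1))) (at a)"
  unfolding mixed_eval_mixed_cubic z1_def z2_def
  by (rule derivative_eq_intros has_derivative_nth refl ext)+
     (simp add: algebra_simps eval_nat_numeral)

text \<open>
  Collecting the terms gives \<open>z (|z|\<^sup>2 + 11 |u|\<^sup>2) = (6 |z|\<^sup>2 + 6 |u|\<^sup>2) u\<close>, so \<open>z\<close> is a real multiple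
  of \<open>u\<close>, and the equation becomes a real cubic for the ratio.
\<close>

lemma mixed_cubic_zero_cases:
  fixes u z :: complex
  assumes "u \<noteq> 0"
    and zero: "z ^ 2 * cnj z - 6 * u * z * cnj z + 11 * u * cnj u * z - 6 * u ^ 2 * cnj u = 0"
  shows "\<exists>t\<in>{1, 2, 3::real}. z = of_real t * u"
proof -
  define r s where "r = (cmod z)\<^sup>2" and "s = (cmod u)\<^sup>2"
  have r: "of_real r = z * cnj z" and s: "of_real s = u * cnj u"
    by (simp_all add: r_def s_def complex_norm_square flip: of_real_power)
  have "s > 0" "r \<ge> 0"
    using \<open>u \<noteq> 0\<close> by (simp_all add: r_def s_def)
  \<comment> \<open>The real number that solves the collected equation for \<open>z / u\<close>.\<close>
  define t where "t = (6 * r + 6 * s) / (r + 11 * s)"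
  have "z * of_real (r + 11 * s) = of_real (6 * r + 6 * s) * u"
    using zero by (simp add: r s algebra_simps power2_eq_square)
  moreover have "complex_of_real (r + 11 * s) \<noteq> 0"
    using \<open>s > 0\<close> \<open>r \<ge> 0\<close> by (simp only: of_real_eq_0_iff)
  ultimately have z: "z = of_real t * u"
    by (simp add: t_def nonzero_eq_divide_eq del: of_real_add)
  have "of_real ((t - 1) * (t - 2) * (t - 3)) * (u ^ 2 * cnj u) = 0"
    using zero unfolding z by (simp add: algebra_simps power2_eq_square)
  then have "(t - 1) * (t - 2) * (t - 3) = 0"
    using \<open>u \<noteq> 0\<close> by (simp del: of_real_mult of_real_diff)
  then show ?thesis
    using z by auto
qed

lemma mixed_cubic_not_critical:
  assumes "a \<in> complex_torus"
  shows "\<not> mixed_critical_point mixed_cubic a"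
proof -
  define z1 z2 where "z1 = a $ 1" and "z2 = a $ 2"
  define u where "u = z1 ^ 2"
  have nz: "z1 \<noteq> 0" "z2 \<noteq> 0"
    using assms by (auto simp: complex_torus_def z1_def z2_def)
  define \<alpha> \<beta> where "\<alpha> = 2 * z2 * cnj z2 - 6 * z1 ^ 2 * cnj z2 + 11 * z1 ^ 2 * cnj z1 ^ 2"
    and "\<beta> = z2 ^ 2 - 6 * z1 ^ 2 * z2"
  define \<gamma> \<delta> where "\<gamma> = - 12 * z1 * z2 * cnj z2 + 22 * z1 * cnj z1 ^ 2 * z2 - 24 * z1 ^ 3 * cnj z1 ^ 2"
    and "\<delta> = 22 * z1 ^ 2 * cnj z1 * z2 - 12 * z1 ^ 4 * cnj z1"
  define D where "D = (\<lambda>v :: complex ^ 2. \<alpha> * v $ 2 + \<beta> * cnj (v $ 2) + \<gamma> * v $ 1 + \<delta> * cnj (v $ 1))"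
  have D: "(mixed_eval mixed_cubic has_derivative D) (at a)"
    using has_derivative_mixed_cubic[of a]
    unfolding D_def \<alpha>_def \<beta>_def \<gamma>_def \<delta>_def z1_def z2_def .
  define c where "c = mixed_eval mixed_cubic a"
  have c: "c = z2 ^ 2 * cnj z2 - 6 * z1 ^ 2 * z2 * cnj z2
      + 11 * z1 ^ 2 * cnj z1 ^ 2 * z2 - 6 * z1 ^ 4 * cnj z1 ^ 2"
    by (simp add: c_def mixed_eval_mixed_cubic z1_def z2_def)
  have "\<exists>v. D v = w" for w
  proof (cases "c = 0")
    case True
    have "u ^ 2 = z1 ^ 4"
      by (simp add: u_def flip: power_mult)
    with True have "z2 ^ 2 * cnj z2 - 6 * u * z2 * cnj z2 + 11 * u * cnj u * z2 - 6 * u ^ 2 * cnj u = 0"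
      unfolding c by (simp add: u_def)
    moreover have "u \<noteq> 0"
      using nz by (simp add: u_def)
    ultimately obtain t :: real where t: "t \<in> {1, 2, 3}" and z2: "z2 = of_real t * u"
      using mixed_cubic_zero_cases by blast
    have "\<alpha> = of_real (2 * t ^ 2 - 6 * t + 11) * (u * cnj u)"
      unfolding \<alpha>_def z2 by (simp add: u_def algebra_simps power2_eq_square)
    moreover have "\<beta> = of_real (t ^ 2 - 6 * t) * u ^ 2"
      unfolding \<beta>_def z2 by (simp add: u_def algebra_simps power2_eq_square)
    ultimately have "cmod \<alpha> = \<bar>2 * t ^ 2 - 6 * t + 11\<bar> * (cmod u)\<^sup>2"
      "cmod \<beta> = \<bar>t ^ 2 - 6 * t\<bar> * (cmod u)\<^sup>2"
      by (simp_all only: norm_mult norm_of_real complex_mod_cnj norm_power power2_eq_square)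
    moreover have "\<bar>2 * t ^ 2 - 6 * t + 11\<bar> \<noteq> \<bar>t ^ 2 - 6 * t\<bar>"
      using t by auto
    ultimately have "cmod \<alpha> \<noteq> cmod \<beta>"
      using \<open>u \<noteq> 0\<close> by simp
    then obtain h where "\<alpha> * h + \<beta> * cnj h = w"
      using surj_wirtinger by blast
    then have "D (axis 2 h) = w"
      by (simp add: D_def axis_def)
    then show ?thesis ..
  next
    case False
    \<comment> \<open>Velocities of the orbits of \<open>(s z\<^sub>1, s\<^sup>2 z\<^sub>2)\<close>, for \<open>s > 0\<close> and for \<open>|s| = 1\<close>.\<close>
    define radial polar :: "complex ^ 2"
      where "radial = vector [z1, 2 * z2]" and "polar = vector [\<i> * z1, \<i> * (2 * z2)]"
    have "D radial = of_real 6 * c"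
      by (simp add: D_def radial_def c \<alpha>_def \<beta>_def \<gamma>_def \<delta>_def algebra_simps eval_nat_numeral)
    moreover have "D polar = \<i> * of_real 2 * c"
      by (simp add: D_def polar_def c \<alpha>_def \<beta>_def \<gamma>_def \<delta>_def algebra_simps eval_nat_numeral)
    moreover obtain x y :: real where "x *\<^sub>R (of_real 6 * c) + y *\<^sub>R (\<i> * of_real 2 * c) = w"
      using surj_rotated_pair[of c 6 2 w] False by auto
    moreover have "D (x *\<^sub>R radial + y *\<^sub>R polar) = x *\<^sub>R D radial + y *\<^sub>R D polar"
      using has_derivative_linear[OF D] by (simp add: linear_add linear_scale)
    ultimately show ?thesis
      by metis
  qed
  then show ?thesis
    by (rule not_mixed_critical_pointI[OF D])
qed

lemma mixed_cubic_surj_torus: "mixed_eval mixed_cubic ` complex_torus = UNIV"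
proof -
  have "\<exists>a\<in>complex_torus. mixed_eval mixed_cubic a = w" for w
  proof (cases "w = 0")
    case True
    then have "mixed_eval mixed_cubic (vector [1, 1]) = w"
      by (simp add: mixed_eval_mixed_cubic)
    then show ?thesis
      by (intro bexI) (auto simp: complex_torus_def forall_2)
  next
    case False
    \<comment> \<open>Solve \<open>u |u|\<^sup>2 = w / 6\<close>: the modulus of \<open>u\<close> must be the cube root of that of \<open>w / 6\<close>.\<close>
    define r where "r = root 3 (cmod (w / 6))"
    have "r > 0"
      using False by (simp add: r_def)
    have "r ^ 3 = cmod (w / 6)"
      by (simp add: r_def)
    define u where "u = (w / 6) / of_real (r ^ 2)"
    have "cmod u = r"
      using \<open>r > 0\<close> \<open>r ^ 3 = cmod (w / 6)\<close>
      by (simp add: u_def norm_divide norm_mult power2_eq_square power3_eq_cube field_simps)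
    have u: "u * (u * cnj u) = w / 6"
      unfolding complex_norm_square[symmetric] \<open>cmod u = r\<close>
      using \<open>r > 0\<close> by (simp add: u_def)
    define z1 where "z1 = csqrt u"
    have "z1 ^ 2 = u"
      by (simp add: z1_def)
    moreover from this have "z1 ^ 4 = u ^ 2" "cnj z1 ^ 2 = cnj u"
      by (metis power_mult mult_2 numeral_Bit0, metis complex_cnj_power)
    ultimately have "mixed_eval mixed_cubic (vector [z1, 4 * u]) = 6 * (u * (u * cnj u))"
      by (simp add: mixed_eval_mixed_cubic) (simp add: power2_eq_square)
    then have "mixed_eval mixed_cubic (vector [z1, 4 * u]) = w"
      by (simp add: u)
    moreover have "u \<noteq> 0"
      using \<open>cmod u = r\<close> \<open>r > 0\<close> by auto
    ultimately show ?thesis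
      by (intro bexI) (auto simp: complex_torus_def forall_2 z1_def)
  qed
  then show ?thesis
    by (auto simp: image_iff) metis
qed

text \<open>
  Both Wirtinger derivatives are multiples of \<open>z\<^sup>p cnj z\<^sup>q\<close>: multiplied by \<open>z\<close> and by \<open>cnj z\<close>, they
  become \<open>p\<close> times and \<open>q\<close> times the monomial. Hence their moduli differ when \<open>p \<noteq> q\<close>.
\<close>

lemma pure_monomial_not_critical:
  fixes a :: "complex ^ 'n"
  assumes f: "mixed_eval f = (\<lambda>z. c * (z $ j) ^ p * cnj (z $ j) ^ q)"
    and "c \<noteq> 0" "p \<noteq> q" "a \<in> complex_torus"
  shows "\<not> mixed_critical_point f a"
proof -
  define z where "z = a $ j"
  have "z \<noteq> 0"
    using assms by (simp add: complex_torus_def z_def)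
  define \<alpha> \<beta> where "\<alpha> = c * (of_nat p * z ^ (p - 1)) * cnj z ^ q"
    and "\<beta> = c * z ^ p * (of_nat q * cnj z ^ (q - 1))"
  have "(mixed_eval f has_derivative (\<lambda>v. \<alpha> * v $ j + \<beta> * cnj (v $ j))) (at a)"
    unfolding f \<alpha>_def \<beta>_def z_def
    by (rule derivative_eq_intros has_derivative_nth refl ext)+ (simp add: algebra_simps)
  moreover have "\<exists>v :: complex ^ 'n. \<alpha> * v $ j + \<beta> * cnj (v $ j) = w" for w
  proof -
    have "\<alpha> * z = of_nat p * (c * z ^ p * cnj z ^ q)"
      by (cases p) (simp_all add: \<alpha>_def algebra_simps)
    moreover have "\<beta> * cnj z = of_nat q * (c * z ^ p * cnj z ^ q)"
      by (cases q) (simp_all add: \<beta>_def algebra_simps)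
    ultimately have "cmod \<alpha> * cmod z = of_nat p * cmod (c * z ^ p * cnj z ^ q)"
      "cmod \<beta> * cmod z = of_nat q * cmod (c * z ^ p * cnj z ^ q)"
      by (metis norm_mult norm_of_nat, metis complex_mod_cnj norm_mult norm_of_nat)
    moreover have "c * z ^ p * cnj z ^ q \<noteq> 0"
      using \<open>z \<noteq> 0\<close> \<open>c \<noteq> 0\<close> by simp
    ultimately have "cmod \<alpha> \<noteq> cmod \<beta>"
      using \<open>p \<noteq> q\<close> by (metis mult_right_cancel norm_eq_zero of_nat_eq_iff)
    then obtain h where "\<alpha> * h + \<beta> * cnj h = w"
      using surj_wirtinger by blast
    then have "\<alpha> * (axis j h :: complex ^ 'n) $ j + \<beta> * cnj ((axis j h :: complex ^ 'n) $ j) = w"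
      by simp
    then show ?thesis ..
  qed
  ultimately show ?thesis
    by (rule not_mixed_critical_pointI)
qed

section \<open>Exponents\<close>

text \<open>
  The exponent of \<open>z\<^sub>1\<^sup>a z\<^sub>2\<^sup>b (cnj z\<^sub>1)\<^sup>c (cnj z\<^sub>2)\<^sup>d\<close>.
\<close>

definition key :: "nat \<Rightarrow> nat \<Rightarrow> nat \<Rightarrow> nat \<Rightarrow> (nat ^ 2) \<times> (nat ^ 2)" where
  "key a b c d = (vector [a, b], vector [c, d])"

lemma key_eq_iff [simp]: "key a b c d = key a' b' c' d' \<longleftrightarrow> a = a' \<and> b = b' \<and> c = c' \<and> d = d'"
  by (auto simp: key_def vec_eq_iff forall_2)

lemma radial_exponent_key: "radial_exponent (key a b c d) = vector [real (a + c), real (b + d)]"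
  by (simp add: radial_exponent_def key_def vec_eq_iff forall_2)

lemma Z_power: "Z j ^ m = Poly_Mapping.single (axis j m, 0) 1"
proof (induction m)
  case 0
  have "(axis j 0 :: nat ^ 'a) = 0"
    by (simp add: vec_eq_iff axis_def)
  then show ?case
    unfolding power_0 by (metis single_one zero_prod_def)
next
  case (Suc m)
  have "axis j 1 + axis j m = (axis j (Suc m) :: nat ^ 'a)"
    by (simp add: vec_eq_iff axis_def)
  then show ?case
    unfolding power_Suc Suc.IH by (simp add: Z_def mult_single)
qed

lemma Zbar_power: "Zbar j ^ m = Poly_Mapping.single (0, axis j m) 1"
proof (induction m)
  case 0
  have "(axis j 0 :: nat ^ 'a) = 0"
    by (simp add: vec_eq_iff axis_def)
  then show ?case
    unfolding power_0 by (metis single_one zero_prod_def)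
next
  case (Suc m)
  have "axis j 1 + axis j m = (axis j (Suc m) :: nat ^ 'a)"
    by (simp add: vec_eq_iff axis_def)
  then show ?case
    unfolding power_Suc Suc.IH by (simp add: Zbar_def mult_single)
qed

lemma single_key:
  "Poly_Mapping.single (key a b c d) x
     = Poly_Mapping.single 0 x * Z 1 ^ a * Z 2 ^ b * Zbar 1 ^ c * Zbar 2 ^ d"
proof -
  have "key a b c d = (axis 1 a + axis 2 b, axis 1 c + axis 2 d)"
    by (simp add: key_def vec_eq_iff forall_2 axis_def)
  then show ?thesis
    by (simp add: Z_power Zbar_power mult_single)
qed

lemma single_zero_uminus_numeral:
  "Poly_Mapping.single 0 (- numeral m) = (- numeral m :: 'a::monoid_add \<Rightarrow>\<^sub>0 complex)"
  by (simp add: single_uminus single_numeral)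

lemma mixed_cubic_monomials:
  "mixed_cubic = Poly_Mapping.single (key 0 2 0 1) 1 + Poly_Mapping.single (key 2 1 0 1) (- 6)
     + Poly_Mapping.single (key 2 1 2 0) 11 + Poly_Mapping.single (key 4 0 2 0) (- 6)"
  by (simp add: mixed_cubic_def single_key single_zero_uminus_numeral single_numeral single_one
      algebra_simps)

lemma keys_mixed_cubic:
  "Poly_Mapping.keys mixed_cubic = {key 0 2 0 1, key 2 1 0 1, key 2 1 2 0, key 4 0 2 0}"
  by (auto simp: mixed_cubic_monomials in_keys_iff lookup_add lookup_single when_def
      split: if_splits)

section \<open>Newton polyhedron\<close>

text \<open>
  All exponents lie on the line \<open>\<xi>\<^sub>1 + 2 \<xi>\<^sub>2 = 6\<close>, and the two extreme ones are its intersections with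
  the axes. So a point on or above the line either dominates \<open>(0, 3)\<close>, or is a convex combination
  of \<open>(0, 3)\<close> and \<open>(6, 0)\<close>, both moved to the right by the same distance.
\<close>

lemma newton_polyhedron_mixed_cubic:
  "newton_polyhedron mixed_cubic = {\<xi>. 0 \<le> \<xi> $ 1 \<and> 0 \<le> \<xi> $ 2 \<and> 6 \<le> \<xi> $ 1 + 2 * \<xi> $ 2}"
    (is "_ = ?H")
proof
  let ?G = "\<Union>k\<in>Poly_Mapping.keys mixed_cubic. {radial_exponent k + \<eta> | \<eta>. \<forall>j. 0 \<le> \<eta> $ j}"
  have "convex ?H"
  proof (rule convexI)
    fix \<xi> \<eta> :: "real ^ 2" and s t :: real
    assume "\<xi> \<in> ?H" "\<eta> \<in> ?H" and st: "0 \<le> s" "0 \<le> t" "s + t = 1"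
    then have "s * 6 \<le> s * (\<xi> $ 1 + 2 * \<xi> $ 2)" "t * 6 \<le> t * (\<eta> $ 1 + 2 * \<eta> $ 2)"
      by (auto intro!: mult_left_mono)
    then show "s *\<^sub>R \<xi> + t *\<^sub>R \<eta> \<in> ?H"
      using \<open>\<xi> \<in> ?H\<close> \<open>\<eta> \<in> ?H\<close> st by (auto simp: algebra_simps)
  qed
  moreover have "?G \<subseteq> ?H"
    by (auto simp: keys_mixed_cubic radial_exponent_key forall_2)
  ultimately show "newton_polyhedron mixed_cubic \<subseteq> ?H"
    unfolding newton_polyhedron_def by (simp add: hull_minimal)
  show "?H \<subseteq> newton_polyhedron mixed_cubic"
  proof
    fix \<xi> :: "real ^ 2"
    assume \<xi>: "\<xi> \<in> ?H"
    have above: "\<eta> \<in> ?G"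
      if "k \<in> Poly_Mapping.keys mixed_cubic" "\<forall>j. radial_exponent k $ j \<le> \<eta> $ j" for k \<eta>
      using that(2) by (intro UN_I[OF that(1)] CollectI exI[of _ "\<eta> - radial_exponent k"]) simp
    have left: "\<eta> \<in> ?G" if "0 \<le> \<eta> $ 1" "3 \<le> \<eta> $ 2" for \<eta> :: "real ^ 2"
      using that by (intro above[of "key 0 2 0 1"])
        (simp_all add: keys_mixed_cubic radial_exponent_key forall_2)
    have right: "\<eta> \<in> ?G" if "6 \<le> \<eta> $ 1" "0 \<le> \<eta> $ 2" for \<eta> :: "real ^ 2"
      using that by (intro above[of "key 4 0 2 0"])
        (simp_all add: keys_mixed_cubic radial_exponent_key forall_2)
    show "\<xi> \<in> newton_polyhedron mixed_cubic"
    proof (cases "3 \<le> \<xi> $ 2")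
      case True
      then show ?thesis
        using left \<xi> unfolding newton_polyhedron_def by (simp add: hull_inc)
    next
      case False
      \<comment> \<open>The distance \<open>x\<close> is the horizontal one from the edge.\<close>
      define x t where "x = \<xi> $ 1 + 2 * \<xi> $ 2 - 6" and "t = \<xi> $ 2 / 3"
      have "0 \<le> x" "0 \<le> t" "t \<le> 1"
        using \<xi> False by (auto simp: x_def t_def)
      have "\<xi> = t *\<^sub>R vector [x, 3] + (1 - t) *\<^sub>R vector [6 + x, 0]"
        by (simp add: x_def t_def vec_eq_iff forall_2 field_simps)
      moreover have "vector [x, 3] \<in> convex hull ?G" "vector [6 + x, 0] \<in> convex hull ?G"
        using left right \<open>0 \<le> x\<close> by (simp_all add: hull_inc)
      ultimately show ?thesis
        unfolding newton_polyhedron_def using \<open>0 \<le> t\<close> \<open>t \<le> 1\<close>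
        by (auto intro!: convexD[OF convex_convex_hull])
    qed
  qed
qed

lemma newton_face_eqI:
  assumes "v \<in> newton_polyhedron f"
    and "\<And>\<xi>. \<xi> \<in> newton_polyhedron f \<Longrightarrow> weight_form P v \<le> weight_form P \<xi>"
  shows "newton_face f P = {\<xi> \<in> newton_polyhedron f. weight_form P \<xi> = weight_form P v}"
proof -
  have "weight_min f P = weight_form P v"
    unfolding weight_min_def using assms by (intro cInf_eq_minimum) auto
  then show ?thesis
    by (simp add: newton_face_def)
qed

lemma weight_form_2:
  fixes P :: "nat ^ 2"
  shows "weight_form P \<xi> = real (P $ 1) * \<xi> $ 1 + real (P $ 2) * \<xi> $ 2"
  by (simp add: weight_form_def sum_2)

text \<open>
  On the polyhedron, \<open>2 (p \<xi>\<^sub>1 + q \<xi>\<^sub>2 - 3 q)\<close> is the sum of the nonnegative terms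
  \<open>(2 p - q) \<xi>\<^sub>1\<close> and \<open>q (\<xi>\<^sub>1 + 2 \<xi>\<^sub>2 - 6)\<close>, which vanish together only at \<open>(0, 3)\<close>.
\<close>

lemma newton_face_z2_vertex:
  assumes "P $ 2 < 2 * P $ 1" "0 < P $ 2"
  shows "newton_face mixed_cubic P = {vector [0, 3]}"
proof -
  define p q where "p = real (P $ 1)" and "q = real (P $ 2)"
  have pq: "q < 2 * p" "0 < q"
    using assms by (auto simp: p_def q_def)
  have gap: "2 * (p * \<xi> $ 1 + q * \<xi> $ 2 - q * 3)
      = (2 * p - q) * \<xi> $ 1 + q * (\<xi> $ 1 + 2 * \<xi> $ 2 - 6)" for \<xi> :: "real ^ 2"
    by (simp add: algebra_simps)
  have parts: "0 \<le> (2 * p - q) * \<xi> $ 1" "0 \<le> q * (\<xi> $ 1 + 2 * \<xi> $ 2 - 6)"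
    if "\<xi> \<in> newton_polyhedron mixed_cubic" for \<xi>
    using that pq by (auto simp: newton_polyhedron_mixed_cubic)
  have "newton_face mixed_cubic P =
      {\<xi> \<in> newton_polyhedron mixed_cubic. weight_form P \<xi> = weight_form P (vector [0, 3])}"
  proof (rule newton_face_eqI)
    fix \<xi> assume "\<xi> \<in> newton_polyhedron mixed_cubic"
    then show "weight_form P (vector [0, 3]) \<le> weight_form P \<xi>"
      using parts[of \<xi>] gap[of \<xi>] by (simp add: weight_form_2 flip: p_def q_def)
  qed (simp add: newton_polyhedron_mixed_cubic)
  moreover have "\<xi> = vector [0, 3]"
    if "\<xi> \<in> newton_polyhedron mixed_cubic" "weight_form P \<xi> = weight_form P (vector [0, 3])" for \<xi>
  proof -
    have "p * \<xi> $ 1 + q * \<xi> $ 2 - q * 3 = 0"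
      using that(2) by (simp add: weight_form_2 flip: p_def q_def)
    then have "(2 * p - q) * \<xi> $ 1 = 0" "q * (\<xi> $ 1 + 2 * \<xi> $ 2 - 6) = 0"
      using gap[of \<xi>] add_nonneg_eq_0_iff[OF parts[OF that(1)]] by simp_all
    then show ?thesis
      using pq by (simp add: vec_eq_iff forall_2)
  qed
  ultimately show ?thesis
    by (auto simp: newton_polyhedron_mixed_cubic)
qed

text \<open>
  Likewise \<open>p \<xi>\<^sub>1 + q \<xi>\<^sub>2 - 6 p\<close> is the sum of the nonnegative terms \<open>p (\<xi>\<^sub>1 + 2 \<xi>\<^sub>2 - 6)\<close> and
  \<open>(q - 2 p) \<xi>\<^sub>2\<close>, which vanish together only at \<open>(6, 0)\<close>.
\<close>

lemma newton_face_z1_vertex: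
  assumes "2 * P $ 1 < P $ 2" "0 < P $ 1"
  shows "newton_face mixed_cubic P = {vector [6, 0]}"
proof -
  define p q where "p = real (P $ 1)" and "q = real (P $ 2)"
  have pq: "2 * p < q" "0 < p"
    using assms by (auto simp: p_def q_def)
  have gap: "p * \<xi> $ 1 + q * \<xi> $ 2 - p * 6
      = p * (\<xi> $ 1 + 2 * \<xi> $ 2 - 6) + (q - 2 * p) * \<xi> $ 2" for \<xi> :: "real ^ 2"
    by (simp add: algebra_simps)
  have parts: "0 \<le> (q - 2 * p) * \<xi> $ 2" "0 \<le> p * (\<xi> $ 1 + 2 * \<xi> $ 2 - 6)"
    if "\<xi> \<in> newton_polyhedron mixed_cubic" for \<xi>
    using that pq by (auto simp: newton_polyhedron_mixed_cubic)
  have "newton_face mixed_cubic P =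
      {\<xi> \<in> newton_polyhedron mixed_cubic. weight_form P \<xi> = weight_form P (vector [6, 0])}"
  proof (rule newton_face_eqI)
    fix \<xi> assume "\<xi> \<in> newton_polyhedron mixed_cubic"
    then show "weight_form P (vector [6, 0]) \<le> weight_form P \<xi>"
      using parts[of \<xi>] gap[of \<xi>] by (simp add: weight_form_2 flip: p_def q_def)
  qed (simp add: newton_polyhedron_mixed_cubic)
  moreover have "\<xi> = vector [6, 0]"
    if "\<xi> \<in> newton_polyhedron mixed_cubic" "weight_form P \<xi> = weight_form P (vector [6, 0])" for \<xi>
  proof -
    have "p * \<xi> $ 1 + q * \<xi> $ 2 - p * 6 = 0"
      using that(2) by (simp add: weight_form_2 flip: p_def q_def)
    then have "(q - 2 * p) * \<xi> $ 2 = 0" "p * (\<xi> $ 1 + 2 * \<xi> $ 2 - 6) = 0"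
      using gap[of \<xi>] add_nonneg_eq_0_iff[OF parts(2)[OF that(1)] parts(1)[OF that(1)]] by simp_all
    then show ?thesis
      using pq by (simp add: vec_eq_iff forall_2)
  qed
  ultimately show ?thesis
    by (auto simp: newton_polyhedron_mixed_cubic)
qed

lemma keys_subset_newton_face_edge:
  assumes "P $ 2 = 2 * P $ 1"
  shows "radial_exponent ` Poly_Mapping.keys mixed_cubic \<subseteq> newton_face mixed_cubic P"
proof -
  have weight: "weight_form P \<xi> = real (P $ 1) * (\<xi> $ 1 + 2 * \<xi> $ 2)" for \<xi>
    using assms by (simp add: weight_form_2 algebra_simps)
  have "newton_face mixed_cubic P =
      {\<xi> \<in> newton_polyhedron mixed_cubic. weight_form P \<xi> = weight_form P (vector [6, 0])}"
    by (rule newton_face_eqI)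
       (auto simp: newton_polyhedron_mixed_cubic weight intro!: mult_left_mono)
  then show ?thesis
    by (auto simp: keys_mixed_cubic radial_exponent_key newton_polyhedron_mixed_cubic weight)
qed

lemma not_bounded_ray:
  fixes v w :: "'a::real_normed_vector"
  assumes ray: "\<And>s. 0 \<le> s \<Longrightarrow> v + s *\<^sub>R w \<in> A" and "w \<noteq> 0"
  shows "\<not> bounded A"
proof
  assume "bounded A"
  then obtain B where B: "\<And>x. x \<in> A \<Longrightarrow> norm x \<le> B"
    by (auto simp: bounded_iff)
  define s where "s = (\<bar>B\<bar> + norm v + 1) / norm w"
  have "0 \<le> s"
    by (simp add: s_def)
  have "norm (s *\<^sub>R w) = \<bar>B\<bar> + norm v + 1"
    using \<open>w \<noteq> 0\<close> by (simp add: s_def)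
  moreover have "norm (s *\<^sub>R w) \<le> norm (v + s *\<^sub>R w) + norm v"
    by (metis add_diff_cancel_left' norm_triangle_ineq4)
  ultimately show False
    using B[OF ray[OF \<open>0 \<le> s\<close>]] by linarith
qed

text \<open>
  If an entry of the weight is zero, then its minimum on the polyhedron is \<open>0\<close>, and the face contains
  the part of a coordinate axis beyond a vertex.
\<close>

lemma newton_face_not_compact:
  assumes "P $ 1 = 0 \<or> P $ 2 = 0"
  shows "\<not> compact (newton_face mixed_cubic P)"
proof -
  obtain v w :: "real ^ 2" where "w \<noteq> 0"
    and ray: "\<And>s. 0 \<le> s \<Longrightarrow> v + s *\<^sub>R w \<in> newton_polyhedron mixed_cubic"
    and v: "weight_form P v = 0" and w: "weight_form P w = 0"
  proof (cases "P $ 1 = 0")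
    case True
    then show ?thesis
      by (intro that[of "axis 1 1" "vector [6, 0]"])
         (auto simp: newton_polyhedron_mixed_cubic weight_form_2 vec_eq_iff forall_2 axis_def)
  next
    case False
    then show ?thesis
      using assms by (intro that[of "axis 2 1" "vector [0, 3]"])
         (auto simp: newton_polyhedron_mixed_cubic weight_form_2 vec_eq_iff forall_2 axis_def)
  qed
  have "newton_face mixed_cubic P =
      {\<xi> \<in> newton_polyhedron mixed_cubic. weight_form P \<xi> = weight_form P v}"
    using ray[of 0] v
    by (intro newton_face_eqI) (auto simp: newton_polyhedron_mixed_cubic weight_form_2)
  moreover have "weight_form P (v + s *\<^sub>R w) = weight_form P v + s * weight_form P w" for s
    by (simp add: weight_form_2 algebra_simps)
  ultimately have "v + s *\<^sub>R w \<in> newton_face mixed_cubic P" if "0 \<le> s" for s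
    using ray[OF that] w by simp
  then show ?thesis
    using not_bounded_ray \<open>w \<noteq> 0\<close> compact_imp_bounded by blast
qed

section \<open>Face functions\<close>

lemma face_function_all:
  assumes "radial_exponent ` Poly_Mapping.keys f \<subseteq> \<Delta>"
  shows "face_function f \<Delta> = f"
proof -
  have "{k \<in> Poly_Mapping.keys f. radial_exponent k \<in> \<Delta>} = Poly_Mapping.keys f"
    using assms by auto
  then show ?thesis
    by (intro poly_mapping_eqI)
      (simp add: face_function_def lookup_sum lookup_single when_def in_keys_iff)
qed

lemma face_function_z2_vertex: "face_function mixed_cubic {vector [0, 3]} = Z 2 ^ 2 * Zbar 2"
proof -
  have "{k \<in> Poly_Mapping.keys mixed_cubic. radial_exponent k \<in> {vector [0, 3]}} = {key 0 2 0 1}"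
    by (auto simp: keys_mixed_cubic radial_exponent_key vec_eq_iff forall_2)
  moreover have "Poly_Mapping.lookup mixed_cubic (key 0 2 0 1) = 1"
    by (simp add: mixed_cubic_monomials lookup_add lookup_single)
  ultimately show ?thesis
    by (simp add: face_function_def single_key single_one)
qed

lemma face_function_z1_vertex:
  "face_function mixed_cubic {vector [6, 0]} = - 6 * Z 1 ^ 4 * Zbar 1 ^ 2"
proof -
  have "{k \<in> Poly_Mapping.keys mixed_cubic. radial_exponent k \<in> {vector [6, 0]}} = {key 4 0 2 0}"
    by (auto simp: keys_mixed_cubic radial_exponent_key vec_eq_iff forall_2)
  moreover have "Poly_Mapping.lookup mixed_cubic (key 4 0 2 0) = - 6"
    by (simp add: mixed_cubic_monomials lookup_add lookup_single)
  ultimately show ?thesis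
    by (simp add: face_function_def single_key single_zero_uminus_numeral)
qed

lemma z2_vertex_not_critical:
  assumes "a \<in> complex_torus"
  shows "\<not> mixed_critical_point (Z 2 ^ 2 * Zbar 2 :: 2 mixed_poly) a"
  by (rule pure_monomial_not_critical[where c = 1 and j = 2 and p = 2 and q = 1])
     (use assms in auto)

lemma z1_vertex_not_critical:
  assumes "a \<in> complex_torus"
  shows "\<not> mixed_critical_point (- 6 * Z 1 ^ 4 * Zbar 1 ^ 2 :: 2 mixed_poly) a"
  by (rule pure_monomial_not_critical[where c = "- 6" and j = 1 and p = 4 and q = 2])
     (use assms in \<open>auto simp: mixed_eval_uminus\<close>)

lemma strongly_newton_nondegenerate_mixed_cubic: "strongly_newton_nondegenerate mixed_cubic"
  unfolding strongly_newton_nondegenerate_def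
proof (intro conjI allI impI)
  show "mixed_eval mixed_cubic 0 = 0"
    by (simp add: mixed_eval_mixed_cubic)
next
  fix \<Delta> assume "compact_face mixed_cubic \<Delta>"
  then obtain P where \<Delta>: "\<Delta> = newton_face mixed_cubic P" and "compact \<Delta>"
    by (auto simp: compact_face_def)
  then have "0 < P $ 1" "0 < P $ 2"
    using newton_face_not_compact by (metis gr0I)+
  then consider "P $ 2 < 2 * P $ 1" | "2 * P $ 1 < P $ 2" | "P $ 2 = 2 * P $ 1"
    by linarith
  then show "strongly_nondegenerate_over mixed_cubic \<Delta>"
  proof cases
    case 1
    then show ?thesis
      using \<open>0 < P $ 2\<close> z2_vertex_not_critical
      by (simp add: \<Delta> newton_face_z2_vertex strongly_nondegenerate_over_def face_function_z2_vertex)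
  next
    case 2
    then show ?thesis
      using \<open>0 < P $ 1\<close> z1_vertex_not_critical
      by (simp add: \<Delta> newton_face_z1_vertex strongly_nondegenerate_over_def face_function_z1_vertex)
  next
    case 3
    then show ?thesis
      by (simp add: \<Delta> keys_subset_newton_face_edge face_function_all strongly_nondegenerate_over_def
          mixed_cubic_not_critical mixed_cubic_surj_torus)
  qed
qed

theorem lemma14:
  fixes f :: "2 mixed_poly" and S T :: "nat ^ 2"
  assumes f: "f = Z 2 ^ 2 * Zbar 2 - 6 * Z 1 ^ 2 * Z 2 * Zbar 2
                + 11 * Z 1 ^ 2 * Zbar 1 ^ 2 * Z 2 - 6 * Z 1 ^ 4 * Zbar 1 ^ 2"
    and S: "S = vector [1, 1]"
    and T: "T = vector [1, 3]"
  shows "(\<forall>a\<in>complex_torus. \<not> mixed_critical_point f a) \<and>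
    mixed_eval f ` complex_torus = UNIV \<and>
    (compact_face f (newton_face f S) \<and> aff_dim (newton_face f S) = 0 \<and>
     face_function f (newton_face f S) = Z 2 ^ 2 * Zbar 2 \<and>
     (\<forall>a\<in>complex_torus. \<not> mixed_critical_point (face_function f (newton_face f S)) a)) \<and>
    (compact_face f (newton_face f T) \<and> aff_dim (newton_face f T) = 0 \<and>
     face_function f (newton_face f T) = - 6 * Z 1 ^ 4 * Zbar 1 ^ 2 \<and>
     (\<forall>a\<in>complex_torus. \<not> mixed_critical_point (face_function f (newton_face f T)) a)) \<and>
    strongly_newton_nondegenerate f"
proof -
  have f: "f = mixed_cubic"
    by (simp add: f mixed_cubic_def)
  have face_S: "newton_face mixed_cubic S = {vector [0, 3]}"
    and face_T: "newton_face mixed_cubic T = {vector [6, 0]}"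
    by (simp_all add: S T newton_face_z2_vertex newton_face_z1_vertex)
  have "S \<noteq> 0" "T \<noteq> 0"
    by (simp_all add: S T vec_eq_iff forall_2)
  then have "compact_face mixed_cubic {vector [0, 3]}" "compact_face mixed_cubic {vector [6, 0]}"
    unfolding compact_face_def using face_S face_T by (metis compact_sing)+
  then show ?thesis
    unfolding f face_S face_T
    using mixed_cubic_not_critical mixed_cubic_surj_torus z2_vertex_not_critical
      z1_vertex_not_critical strongly_newton_nondegenerate_mixed_cubic
    by (simp add: face_function_z2_vertex face_function_z1_vertex)
qed

end
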